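(* Let $p$ be a prime, $s>0$, and let $F\subset\mathbb{Z}_p$ be a closed set with $\mathcal{H}^s(F)<\infty$. Suppose that there is a constant $C>0$ such that $$\limsup_{|I|\to\infty}\frac{|F\cap B\cap I|}{|B\cap I|^s}\le C$$ for every ball $B\subset\mathbb{Z}_p$. Then $$\mathcal{H}_s(F\cap\mathbb{Z})\le\int_F\eta_s(F;x)\,d\mathcal{H}^s(x).$$
   Context: $\mathbb{Z}_p$ is the ring of $p$-adic integers with metric $|x-y|_p$; balls are the sets $B_r(x)=\{y\in\mathbb{Z}_p:|x-y|_p\le r\}$ with $r=p^{-n}$, $n\ge0$. $I$ always denotes an interval of integers $(M,N]=\{M+1,\dots,N\}\subset\mathbb{Z}$ with $|I|=N-M$, $|A|$ is the cardinality of a finite set $A$, and $\limsup_{|I|\to\infty}f(I)=\lim_{L\to\infty}\sup\{f(I):|I|\ge L\}$ over all intervals. The $s$-counting measure of $E\subset\mathbb{Z}$ is $\mathcal{H}_s(E)=\limsup_{|I|\to\infty}\frac{|E\cap I|}{|I|^s}\in[0,\infty]$. For $F\subset\mathbb{Z}_p$, $x\in\mathbb{Z}_p$, $n\in\mathbb{N}$: $\eta_s(F;x,n)=\limsup_{|I|\to\infty}\frac{|F\cap B_{p^{-n}}(x)\cap I|}{|B_{p^{-n}}(x)\cap I|^s}$ and $\eta_s(F;x)=\limsup_{n\to\infty}\eta_s(F;x,n)$. $\mathcal{H}^s$ is the $s$-dimensional Hausdorff measure on $\mathbb{Z}_p$: $\mathcal{H}^s(F)=\lim_{\delta\to0}\inf\{\sum_i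 r_i^s\}$, the infimum being over countable covers of $F$ by balls $B_{r_i}(a_i)$ with $r_i<\delta$. *)

theory Defs
  imports "HOL-Analysis.Analysis" "HOL-Computational_Algebra.Primes"
begin

section \<open>The $p$-adic integers\<close>

text \<open>
  A $p$-adic integer is a coherent sequence of residues: \<open>x n\<close> is the canonical representative of
  the residue class of \<open>x\<close> modulo \<open>p ^ n\<close>.
\<close>

type_synonym padic = "nat \<Rightarrow> int"

definition padic_ints :: "nat \<Rightarrow> padic set" where
  "padic_ints p = {x. \<forall>n. x n \<in> {0..<int p ^ n} \<and> x (Suc n) mod int p ^ n = x n}"

definition padic_of_int :: "nat \<Rightarrow> int \<Rightarrow> padic" where
  "padic_of_int p k = (\<lambda>n. k mod int p ^ n)"

definition padic_diff :: "nat \<Rightarrow> padic \<Rightarrow> padic \<Rightarrow> padic" where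
  "padic_diff p x y = (\<lambda>n. (x n - y n) mod int p ^ n)"

text \<open>
  For \<open>z \<noteq> 0\<close> the exponent below is the $p$-adic valuation of \<open>z\<close>: the largest \<open>n\<close> such that
  \<open>z\<close> vanishes modulo \<open>p ^ n\<close>.
\<close>

definition padic_abs :: "nat \<Rightarrow> padic \<Rightarrow> real" where
  "padic_abs p z = (if z = (\<lambda>_. 0) then 0 else 1 / real p ^ (GREATEST n. z n = 0))"

definition padic_dist :: "nat \<Rightarrow> padic \<Rightarrow> padic \<Rightarrow> real" where
  "padic_dist p x y = padic_abs p (padic_diff p x y)"

abbreviation padic_topology :: "nat \<Rightarrow> padic topology" where
  "padic_topology p \<equiv> Metric_space.mtopology (padic_ints p) (padic_dist p)"

text \<open>The closed ball of radius \<open>p\<close> to the power \<open>- n\<close>.\<close>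

definition padic_ball :: "nat \<Rightarrow> padic \<Rightarrow> nat \<Rightarrow> padic set" where
  "padic_ball p x n = Metric_space.mcball (padic_ints p) (padic_dist p) x (1 / real p ^ n)"

lemma padic_ints_mod:
  assumes "x \<in> padic_ints p" "m \<le> n"
  shows "x n mod int p ^ m = x m"
  using assms(2)
proof (induction rule: dec_induct)
  case base
  show ?case using assms(1) by (simp add: padic_ints_def)
next
  case (step n)
  have "x (Suc n) mod int p ^ m = x (Suc n) mod int p ^ n mod int p ^ m"
    using step(1) by (simp add: mod_mod_cancel le_imp_power_dvd)
  also have "x (Suc n) mod int p ^ n = x n"
    using assms(1) by (simp add: padic_ints_def)
  finally show ?case using step by simp
qed

lemma padic_diff_eq_0_iff:
  assumes "x \<in> padic_ints p" "y \<in> padic_ints p"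
  shows "padic_diff p x y n = 0 \<longleftrightarrow> x n = y n"
proof -
  have "x n mod int p ^ n = x n" "y n mod int p ^ n = y n"
    using assms padic_ints_mod by blast+
  thus ?thesis
    unfolding padic_diff_def by (metis mod_eq_dvd_iff mod_eq_0_iff_dvd)
qed

lemma padic_dist_le_iff:
  assumes "prime p" "x \<in> padic_ints p" "y \<in> padic_ints p"
  shows "padic_dist p x y \<le> 1 / real p ^ n \<longleftrightarrow> x n = y n"
proof (cases "x = y")
  case True
  thus ?thesis by (auto simp: padic_dist_def padic_abs_def padic_diff_def)
next
  case False
  have p: "real p > 1" using prime_gt_1_nat[OF assms(1)] by simp
  define z where "z = padic_diff p x y"
  have z: "z n = 0 \<longleftrightarrow> x n = y n" for n
    unfolding z_def using assms padic_diff_eq_0_iff by blast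
  from False obtain N where N: "x N \<noteq> y N" by auto
  have mono: "x m = y m" if "x n = y n" "m \<le> n" for m n
    using padic_ints_mod[OF assms(2) that(2)] padic_ints_mod[OF assms(3) that(2)] that(1) by simp
  have bd: "m \<le> N" if "z m = 0" for m
    using mono[of m N] N z that by (meson nat_le_linear)
  have z0: "z 0 = 0" by (simp add: z_def padic_diff_def)
  have G: "z (GREATEST n. z n = 0) = 0"
    by (rule GreatestI_nat[of _ 0 N]) (use z0 bd in auto)
  have "z n = 0 \<longleftrightarrow> n \<le> (GREATEST n. z n = 0)"
  proof
    assume "z n = 0"
    thus "n \<le> (GREATEST n. z n = 0)" by (rule Greatest_le_nat[where b = N]) (use bd in auto)
  next
    assume "n \<le> (GREATEST n. z n = 0)"
    thus "z n = 0" using mono G z by blast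
  qed
  moreover have "z \<noteq> (\<lambda>_. 0)" using N z by metis
  ultimately show ?thesis
    using p z by (simp add: padic_dist_def padic_abs_def flip: z_def) (simp add: field_simps)
qed

lemma padic_dist_cases:
  obtains "padic_dist p x y = 0" | n where "padic_dist p x y = 1 / real p ^ n"
  by (cases "padic_diff p x y = (\<lambda>_. 0)") (simp_all add: padic_dist_def padic_abs_def)

lemma Metric_space_padic:
  assumes "prime p"
  shows "Metric_space (padic_ints p) (padic_dist p)"
proof
  have p: "real p > 1" using prime_gt_1_nat[OF assms] by simp
  note le = padic_dist_le_iff[OF assms]
  show nonneg: "0 \<le> padic_dist p x y" for x y
    by (simp add: padic_dist_def padic_abs_def)
  show "padic_dist p x y = padic_dist p y x" for x y
  proof -
    have "padic_diff p x y n = 0 \<longleftrightarrow> padic_diff p y x n = 0" for n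
      unfolding padic_diff_def by (metis dvd_diff_commute mod_eq_0_iff_dvd)
    thus ?thesis by (auto simp: padic_dist_def padic_abs_def fun_eq_iff)
  qed
  show zero: "padic_dist p x y = 0 \<longleftrightarrow> x = y" if "x \<in> padic_ints p" "y \<in> padic_ints p" for x y
  proof
    assume "padic_dist p x y = 0"
    thus "x = y" using le[OF that] by auto
  qed (auto simp: padic_dist_def padic_abs_def padic_diff_def)
  show "padic_dist p x z \<le> padic_dist p x y + padic_dist p y z"
    if "x \<in> padic_ints p" "y \<in> padic_ints p" "z \<in> padic_ints p" for x y z
  proof (cases rule: padic_dist_cases[of p x y])
    case 1
    thus ?thesis using zero nonneg that by auto
  next
    case m: (2 m)
    show ?thesis
    proof (cases rule: padic_dist_cases[of p y z])
      case 1
      thus ?thesis using zero nonneg that by auto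
    next
      case (2 n)
      have "x m = y m" "y n = z n"
        using m 2 le[OF that(1,2), of m] le[OF that(2,3), of n] by simp_all
      hence "x (min m n) = z (min m n)"
        using padic_ints_mod[OF that(1), of "min m n" m] padic_ints_mod[OF that(2), of "min m n" m]
          padic_ints_mod[OF that(2), of "min m n" n] padic_ints_mod[OF that(3), of "min m n" n]
        by simp
      hence "padic_dist p x z \<le> 1 / real p ^ min m n" using le[OF that(1,3)] by blast
      also have "\<dots> \<le> 1 / real p ^ m + 1 / real p ^ n" by (cases "m \<le> n") (auto simp: min_def)
      finally show ?thesis using m 2 by simp
    qed
  qed
qed

lemma in_padic_ball_iff:
  assumes "prime p"
  shows "y \<in> padic_ball p x n \<longleftrightarrow> x \<in> padic_ints p \<and> y \<in> padic_ints p \<and> x n = y n"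
  using padic_dist_le_iff[OF assms] Metric_space.in_mcball[OF Metric_space_padic[OF assms]]
  unfolding padic_ball_def by blast

lemma padic_of_int_in_padic_ints:
  assumes "prime p"
  shows "padic_of_int p k \<in> padic_ints p"
  using prime_gt_0_nat[OF assms] by (auto simp: padic_ints_def padic_of_int_def mod_mod_cancel)


section \<open>Upper limits over intervals of integers\<close>

definition interval_limsup :: "(int set \<Rightarrow> ennreal) \<Rightarrow> ennreal" where
  "interval_limsup f = Limsup (filtercomap (\<lambda>(M, N). N - M) at_top) (\<lambda>(M, N). f {M<..N})"

lemma interval_limsup_altdef:
  "interval_limsup f = (INF L::nat. SUP I\<in>{I. (\<exists>M N. I = {M<..N}) \<and> L \<le> card I}. f I)"
proof (rule antisym)
  show "interval_limsup f \<le> (INF L::nat. SUP I\<in>{I. (\<exists>M N. I = {M<..N}) \<and> L \<le> card I}. f I)"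
  proof (rule INF_greatest)
    fix L :: nat
    have "eventually (\<lambda>(M, N). int L \<le> N - M) (filtercomap (\<lambda>(M, N). N - M) at_top)"
      unfolding eventually_filtercomap_at_top_linorder by (auto intro: exI[of _ "int L"])
    hence "interval_limsup f \<le> (SUP (M, N)\<in>{(M, N). int L \<le> N - M}. f {M<..N})"
      unfolding interval_limsup_def Limsup_def
      by (intro INF_lower2[of "\<lambda>(M, N). int L \<le> N - M"]) (auto simp: case_prod_beta)
    also have "\<dots> \<le> (SUP I\<in>{I. (\<exists>M N. I = {M<..N}) \<and> L \<le> card I}. f I)"
      by (rule SUP_least) (auto intro!: SUP_upper)
    finally show "interval_limsup f \<le> \<dots>" .
  qed
next
  show "(INF L::nat. SUP I\<in>{I. (\<exists>M N. I = {M<..N}) \<and> L \<le> card I}. f I) \<le> interval_limsup f"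
    unfolding interval_limsup_def Limsup_def
  proof (rule INF_greatest)
    fix P :: "int \<times> int \<Rightarrow> bool"
    assume "P \<in> {P. eventually P (filtercomap (\<lambda>(M, N). N - M) at_top)}"
    then obtain K where K: "\<And>M N. K \<le> N - M \<Longrightarrow> P (M, N)"
      unfolding eventually_filtercomap_at_top_linorder mem_Collect_eq by auto
    have "(SUP I\<in>{I. (\<exists>M N. I = {M<..N}) \<and> nat K + 1 \<le> card I}. f I)
            \<le> (SUP x\<in>Collect P. case x of (M, N) \<Rightarrow> f {M<..N})"
    proof (rule SUP_least)
      fix I assume "I \<in> {I. (\<exists>M N::int. I = {M<..N}) \<and> nat K + 1 \<le> card I}"
      then obtain M N :: int where MN: "I = {M<..N}" "nat K + 1 \<le> card I" by auto
      hence "P (M, N)" by (intro K) auto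
      thus "f I \<le> (SUP x\<in>Collect P. case x of (M, N) \<Rightarrow> f {M<..N})"
        using MN(1) by (intro SUP_upper2[of "(M, N)"]) auto
    qed
    thus "(INF L::nat. SUP I\<in>{I. (\<exists>M N. I = {M<..N}) \<and> L \<le> card I}. f I)
            \<le> (SUP x\<in>Collect P. case x of (M, N) \<Rightarrow> f {M<..N})"
      by (intro INF_lower2[of "nat K + 1"]) auto
  qed
qed

definition counting_measure :: "real \<Rightarrow> int set \<Rightarrow> ennreal" where
  "counting_measure s E =
     interval_limsup (\<lambda>I. ennreal (real (card (E \<inter> I)) / real (card I) powr s))"

text \<open>
  A subset of $\mathbf{Z}_p$ is intersected with a set of integers by taking its preimage under the
  embedding of the integers.
\<close>

definition rel_density :: "nat \<Rightarrow> real \<Rightarrow> padic set \<Rightarrow> padic set \<Rightarrow> ennreal" where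
  "rel_density p s F B =
     interval_limsup (\<lambda>I. ennreal (real (card (padic_of_int p -` (F \<inter> B) \<inter> I)) /
                                   real (card (padic_of_int p -` B \<inter> I)) powr s))"

definition local_density :: "nat \<Rightarrow> real \<Rightarrow> padic set \<Rightarrow> padic \<Rightarrow> ennreal" where
  "local_density p s F x = limsup (\<lambda>n. rel_density p s F (padic_ball p x n))"


section \<open>Hausdorff measure\<close>

text \<open>
  Countable covers are indexed by an arbitrary set \<open>J\<close> of natural numbers, so that finite covers
  are included.
\<close>

definition hausdorff_pre :: "nat \<Rightarrow> real \<Rightarrow> real \<Rightarrow> padic set \<Rightarrow> ennreal" where
  "hausdorff_pre p s \<delta> F =
     (INF (a, k, J) \<in> {(a :: nat \<Rightarrow> padic, k :: nat \<Rightarrow> nat, J :: nat set).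
          (\<forall>i\<in>J. a i \<in> padic_ints p \<and> 1 / real p ^ k i < \<delta>) \<and>
          F \<subseteq> (\<Union>i\<in>J. padic_ball p (a i) (k i))}.
        \<Sum>i. if i \<in> J then ennreal ((1 / real p ^ k i) powr s) else 0)"

text \<open>
  The infimum over covers grows as \<open>\<delta>\<close> decreases, so its limit for \<open>\<delta> \<rightarrow> 0\<close> is a supremum.
\<close>

definition hausdorff_outer :: "nat \<Rightarrow> real \<Rightarrow> padic set \<Rightarrow> ennreal" where
  "hausdorff_outer p s F = (SUP \<delta>\<in>{0<..}. hausdorff_pre p s \<delta> F)"

definition hausdorff_measure :: "nat \<Rightarrow> real \<Rightarrow> padic measure" where
  "hausdorff_measure p s =
     measure_of (padic_ints p) {U. openin (padic_topology p) U} (hausdorff_outer p s)"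

lemma hausdorff_pre_le:
  assumes "\<And>i. i \<in> J \<Longrightarrow> a i \<in> padic_ints p \<and> 1 / real p ^ k i < \<delta>"
    and "F \<subseteq> (\<Union>i\<in>J. padic_ball p (a i) (k i))"
  shows "hausdorff_pre p s \<delta> F \<le> (\<Sum>i. if i \<in> J then ennreal ((1 / real p ^ k i) powr s) else 0)"
  unfolding hausdorff_pre_def by (rule INF_lower2[of "(a, k, J)"]) (use assms in auto)

lemma hausdorff_pre_mono:
  assumes "A \<subseteq> B" "\<epsilon> \<le> \<delta>"
  shows "hausdorff_pre p s \<delta> A \<le> hausdorff_pre p s \<epsilon> B"
  unfolding hausdorff_pre_def by (rule INF_superset_mono) (use assms in fastforce)+

lemma hausdorff_pre_close:
  assumes "hausdorff_pre p s \<delta> F < c"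
  obtains a k J where "\<And>i. i \<in> J \<Longrightarrow> a i \<in> padic_ints p \<and> 1 / real p ^ k i < \<delta>"
    and "F \<subseteq> (\<Union>i\<in>J. padic_ball p (a i) (k i))"
    and "(\<Sum>i. if i \<in> J then ennreal ((1 / real p ^ k i) powr s) else 0) < c"
proof -
  from assms obtain x where x: "x \<in> {(a :: nat \<Rightarrow> padic, k :: nat \<Rightarrow> nat, J :: nat set).
          (\<forall>i\<in>J. a i \<in> padic_ints p \<and> 1 / real p ^ k i < \<delta>) \<and>
          F \<subseteq> (\<Union>i\<in>J. padic_ball p (a i) (k i))}"
      "(case x of (a, k, J) \<Rightarrow> \<Sum>i. if i \<in> J then ennreal ((1 / real p ^ k i) powr s) else 0) < c"
    unfolding hausdorff_pre_def INF_less_iff by (elim bexE)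
  obtain a k J where x_eq: "x = (a, k, J)" by (cases x)
  show ?thesis
    using x unfolding x_eq prod.case mem_Collect_eq by (elim conjE) (rule that, drule (1) bspec)
qed

lemma hausdorff_pre_countably_subadditive:
  "hausdorff_pre p s \<delta> (\<Union>n. A n) \<le> (\<Sum>n. hausdorff_pre p s \<delta> (A n))"
proof (rule ennreal_le_epsilon)
  fix e :: real
  assume fin: "(\<Sum>n. hausdorff_pre p s \<delta> (A n)) < top" and e: "0 < e"
  define good where "good n = (\<lambda>(a :: nat \<Rightarrow> padic, k :: nat \<Rightarrow> nat, J :: nat set).
    (\<forall>i\<in>J. a i \<in> padic_ints p \<and> 1 / real p ^ k i < \<delta>) \<and>
    A n \<subseteq> (\<Union>i\<in>J. padic_ball p (a i) (k i)) \<and>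
    (\<Sum>i. if i \<in> J then ennreal ((1 / real p ^ k i) powr s) else 0)
      \<le> hausdorff_pre p s \<delta> (A n) + ennreal (e * (1/2) ^ Suc n))" for n
  have "\<exists>c. good n c" for n
  proof -
    have "hausdorff_pre p s \<delta> (A n) < top"
      using ennreal_suminf_lessD[OF fin] .
    hence "hausdorff_pre p s \<delta> (A n) < hausdorff_pre p s \<delta> (A n) + ennreal (e * (1/2) ^ Suc n)"
      using e by (auto simp: less_top)
    then obtain a k J where 1: "\<And>i. i \<in> J \<Longrightarrow> a i \<in> padic_ints p \<and> 1 / real p ^ k i < \<delta>"
      and 2: "A n \<subseteq> (\<Union>i\<in>J. padic_ball p (a i) (k i))"
      and 3: "(\<Sum>i. if i \<in> J then ennreal ((1 / real p ^ k i) powr s) else 0)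
             < hausdorff_pre p s \<delta> (A n) + ennreal (e * (1/2) ^ Suc n)"
      by (rule hausdorff_pre_close) (rule that)
    have "good n (a, k, J)"
      unfolding good_def prod.case by (intro conjI ballI 2 less_imp_le[OF 3] 1[THEN conjunct1] 1[THEN conjunct2])
    thus ?thesis ..
  qed
  then obtain c where c: "\<And>n. good n (c n)" by metis
  define a where "a n = fst (c n)" for n
  define k where "k n = fst (snd (c n))" for n
  define J where "J n = snd (snd (c n))" for n
  have good: "good n (a n, k n, J n)" for n
    using c[of n] by (simp add: a_def k_def J_def)
  have cov: "a n i \<in> padic_ints p \<and> 1 / real p ^ k n i < \<delta>" if "i \<in> J n" for n i
    using good[of n] that by (simp add: good_def)
  have sub: "A n \<subseteq> (\<Union>i\<in>J n. padic_ball p (a n i) (k n i))" for n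
    using good[of n] by (simp add: good_def)
  have le: "(\<Sum>i. if i \<in> J n then ennreal ((1 / real p ^ k n i) powr s) else 0)
              \<le> hausdorff_pre p s \<delta> (A n) + ennreal (e * (1/2) ^ Suc n)" for n
    using good[of n] unfolding good_def prod.case by blast
  define f :: "nat \<times> nat \<Rightarrow> ennreal"
    where "f = (\<lambda>(n, i). if i \<in> J n then ennreal ((1 / real p ^ k n i) powr s) else 0)"
  define J' where "J' = {m. snd (prod_decode m) \<in> J (fst (prod_decode m))}"
  define a' where "a' = (\<lambda>m. a (fst (prod_decode m)) (snd (prod_decode m)))"
  define k' where "k' = (\<lambda>m. k (fst (prod_decode m)) (snd (prod_decode m)))"
  have "hausdorff_pre p s \<delta> (\<Union>n. A n)
          \<le> (\<Sum>m. if m \<in> J' then ennreal ((1 / real p ^ k' m) powr s) else 0)"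
  proof (rule hausdorff_pre_le)
    show "(\<Union>n. A n) \<subseteq> (\<Union>m\<in>J'. padic_ball p (a' m) (k' m))"
    proof
      fix x assume "x \<in> (\<Union>n. A n)"
      then obtain n i where "i \<in> J n" "x \<in> padic_ball p (a n i) (k n i)" using sub by blast
      thus "x \<in> (\<Union>m\<in>J'. padic_ball p (a' m) (k' m))"
        by (intro UN_I[of "prod_encode (n, i)"]) (auto simp: J'_def a'_def k'_def)
    qed
  qed (use cov in \<open>auto simp: J'_def a'_def k'_def\<close>)
  also have "\<dots> = (\<Sum>m. f (prod_decode m))"
    by (auto simp: f_def J'_def k'_def case_prod_beta intro!: suminf_cong)
  also have "\<dots> = (\<Sum>n. \<Sum>i. f (n, i))"
    using suminf_ennreal_2dimen[of "\<lambda>n. \<Sum>i. f (n, i)" f] by (simp only: comp_def)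
  also have "\<dots> \<le> (\<Sum>n. hausdorff_pre p s \<delta> (A n) + ennreal (e * (1/2) ^ Suc n))"
    by (rule suminf_le[OF _ summableI summableI]) (use le in \<open>simp only: f_def prod.case\<close>)
  also have "\<dots> = (\<Sum>n. hausdorff_pre p s \<delta> (A n)) + (\<Sum>n. ennreal (e * (1/2) ^ Suc n))"
    by (rule suminf_add[OF summableI summableI, symmetric])
  also have "(\<Sum>n. ennreal (e * (1/2) ^ Suc n)) = ennreal e"
  proof (rule suminf_ennreal_eq)
    show "(\<lambda>n. e * (1/2) ^ Suc n) sums e"
      using sums_mult[OF power_half_series, of e] by simp
  qed (use e in simp)
  finally show "hausdorff_pre p s \<delta> (\<Union>n. A n) \<le> (\<Sum>n. hausdorff_pre p s \<delta> (A n)) + ennreal e" .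
qed

lemma outer_measure_space_hausdorff:
  "outer_measure_space (Pow (padic_ints p)) (hausdorff_outer p s)"
  unfolding outer_measure_space_def
proof (intro conjI)
  have "hausdorff_pre p s \<delta> {} = 0" for \<delta>
    using hausdorff_pre_le[of "{}" undefined p undefined \<delta> "{}" s] by simp
  thus "positive (Pow (padic_ints p)) (hausdorff_outer p s)"
    by (simp add: positive_def hausdorff_outer_def)
  show "increasing (Pow (padic_ints p)) (hausdorff_outer p s)"
    by (auto simp: increasing_def hausdorff_outer_def intro!: SUP_mono' hausdorff_pre_mono)
  show "countably_subadditive (Pow (padic_ints p)) (hausdorff_outer p s)"
    unfolding countably_subadditive_def
  proof (intro allI impI)
    fix A :: "nat \<Rightarrow> padic set"
    show "hausdorff_outer p s (\<Union>n. A n) \<le> (\<Sum>n. hausdorff_outer p s (A n))"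
      unfolding hausdorff_outer_def[of p s "\<Union>n. A n"]
    proof (rule SUP_least)
      fix \<delta> :: real assume \<delta>: "\<delta> \<in> {0<..}"
      have "hausdorff_pre p s \<delta> (\<Union>n. A n) \<le> (\<Sum>n. hausdorff_pre p s \<delta> (A n))"
        by (rule hausdorff_pre_countably_subadditive)
      also have "\<dots> \<le> (\<Sum>n. hausdorff_outer p s (A n))"
        using \<delta> unfolding hausdorff_outer_def by (intro suminf_le SUP_upper) auto
      finally show "hausdorff_pre p s \<delta> (\<Union>n. A n) \<le> \<dots>" .
    qed
  qed
qed

lemma hausdorff_pre_split:
  assumes "prime p" "\<delta> \<le> 1 / real p ^ m"
  shows "hausdorff_pre p s \<delta> (X \<inter> padic_ball p b m) + hausdorff_pre p s \<delta> (X - padic_ball p b m)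
           \<le> hausdorff_pre p s \<delta> X"
  unfolding hausdorff_pre_def[of p s \<delta> X]
proof (rule INF_greatest, clarify)
  fix a :: "nat \<Rightarrow> padic" and k :: "nat \<Rightarrow> nat" and J :: "nat set"
  assume *: "\<forall>i\<in>J. a i \<in> padic_ints p \<and> 1 / real p ^ k i < \<delta>"
    and X: "X \<subseteq> (\<Union>i\<in>J. padic_ball p (a i) (k i))"
  have p: "real p > 1" using prime_gt_1_nat[OF assms(1)] by simp
  define B where "B = padic_ball p b m"
  define J1 where "J1 = {i\<in>J. a i \<in> B}"
  define J2 where "J2 = {i\<in>J. a i \<notin> B}"
  have mem: "x \<in> B \<longleftrightarrow> a i \<in> B" if "i \<in> J" "x \<in> padic_ball p (a i) (k i)" for i x
  proof -
    have "1 / real p ^ k i < 1 / real p ^ m" using * that assms(2) by fastforce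
    hence "m < k i" using p by (simp add: divide_simps)
    hence "x m = a i m"
      using that padic_ints_mod[of _ p m "k i"] in_padic_ball_iff[OF assms(1)]
      by (metis less_imp_le)
    thus ?thesis using that * in_padic_ball_iff[OF assms(1)] unfolding B_def by auto
  qed
  have "hausdorff_pre p s \<delta> (X \<inter> B) \<le> (\<Sum>i. if i \<in> J1 then ennreal ((1 / real p ^ k i) powr s) else 0)"
    by (rule hausdorff_pre_le[where a = a]) (use * X mem in \<open>fastforce simp: J1_def\<close>)+
  moreover have "hausdorff_pre p s \<delta> (X - B) \<le> (\<Sum>i. if i \<in> J2 then ennreal ((1 / real p ^ k i) powr s) else 0)"
    by (rule hausdorff_pre_le[where a = a]) (use * X mem in \<open>fastforce simp: J2_def\<close>)+
  ultimately have "hausdorff_pre p s \<delta> (X \<inter> B) + hausdorff_pre p s \<delta> (X - B)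
     \<le> (\<Sum>i. if i \<in> J1 then ennreal ((1 / real p ^ k i) powr s) else 0) +
       (\<Sum>i. if i \<in> J2 then ennreal ((1 / real p ^ k i) powr s) else 0)"
    by (rule add_mono)
  also have "\<dots> = (\<Sum>i. (if i \<in> J1 then ennreal ((1 / real p ^ k i) powr s) else 0) +
                       (if i \<in> J2 then ennreal ((1 / real p ^ k i) powr s) else 0))"
    by (rule suminf_add) auto
  also have "\<dots> = (\<Sum>i. if i \<in> J then ennreal ((1 / real p ^ k i) powr s) else 0)"
    by (rule suminf_cong) (auto simp: J1_def J2_def)
  finally show "hausdorff_pre p s \<delta> (X \<inter> padic_ball p b m) + hausdorff_pre p s \<delta> (X - padic_ball p b m)
     \<le> (\<Sum>i. if i \<in> J then ennreal ((1 / real p ^ k i) powr s) else 0)"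
    by (simp add: B_def)
qed

lemma padic_ball_in_lambda_system:
  assumes "prime p"
  shows "padic_ball p b m
           \<in> lambda_system (padic_ints p) (Pow (padic_ints p)) (hausdorff_outer p s)"
proof -
  interpret sigma_algebra "padic_ints p" "Pow (padic_ints p)" by (rule sigma_algebra_Pow)
  have p: "real p > 0" using prime_gt_0_nat[OF assms] by simp
  let ?B = "padic_ball p b m" and ?H = "hausdorff_outer p s" and ?h = "hausdorff_pre p s"
  have sub: "?B \<subseteq> padic_ints p" using in_padic_ball_iff[OF assms] by blast
  have "?H (X \<inter> ?B) + ?H (X - ?B) = ?H X" if "X \<subseteq> padic_ints p" for X
  proof (rule antisym)
    have le: "?h \<delta> (X \<inter> ?B) + ?h \<epsilon> (X - ?B) \<le> ?H X" if "0 < \<delta>" "0 < \<epsilon>" for \<delta> \<epsilon>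
    proof -
      define \<gamma> where "\<gamma> = Min {\<delta>, \<epsilon>, 1 / real p ^ m}"
      have \<gamma>: "0 < \<gamma>" "\<gamma> \<le> \<delta>" "\<gamma> \<le> \<epsilon>" "\<gamma> \<le> 1 / real p ^ m" using that p by (auto simp: \<gamma>_def)
      have "?h \<delta> (X \<inter> ?B) + ?h \<epsilon> (X - ?B) \<le> ?h \<gamma> (X \<inter> ?B) + ?h \<gamma> (X - ?B)"
        using \<gamma> by (intro add_mono hausdorff_pre_mono) auto
      also have "\<dots> \<le> ?h \<gamma> X" by (rule hausdorff_pre_split[OF assms \<gamma>(4)])
      also have "\<dots> \<le> ?H X" using \<gamma> by (auto simp: hausdorff_outer_def intro!: SUP_upper)
      finally show ?thesis .
    qed
    have le': "?H (X \<inter> ?B) + ?h \<epsilon> (X - ?B) \<le> ?H X" if "0 < \<epsilon>" for \<epsilon>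
      unfolding hausdorff_outer_def[of p s "X \<inter> ?B"]
      by (subst ennreal_SUP_add_left[symmetric]) (use le that in \<open>auto intro!: SUP_least\<close>)
    show "?H (X \<inter> ?B) + ?H (X - ?B) \<le> ?H X"
      unfolding hausdorff_outer_def[of p s "X - ?B"]
      by (subst ennreal_SUP_add_right) (use le' in \<open>auto intro!: SUP_least\<close>)
    have "subadditive (Pow (padic_ints p)) ?H"
      using outer_measure_space_hausdorff[of p s]
      by (auto simp: outer_measure_space_def intro: countably_subadditive_subadditive)
    from subadditiveD[OF this, of "X \<inter> ?B" "X - ?B"] that
    show "?H X \<le> ?H (X \<inter> ?B) + ?H (X - ?B)" by (auto simp: Int_Diff_Un)
  qed
  thus ?thesis using sub by (simp add: lambda_system_eq)
qed

lemma openin_padic_countable_Union_balls: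
  assumes "prime p" "openin (padic_topology p) U"
  obtains \<B> where "countable \<B>" "\<B> \<subseteq> range (case_prod (padic_ball p))" "U = \<Union>\<B>"
proof -
  have p: "real p > 1" using prime_gt_1_nat[OF assms(1)] by simp
  interpret Metric_space "padic_ints p" "padic_dist p" by (rule Metric_space_padic[OF assms(1)])
  note ball = in_padic_ball_iff[OF assms(1)]
  define \<B> where "\<B> = {padic_ball p x n | x n. x \<in> U \<and> padic_ball p x n \<subseteq> U}"
  have U: "U \<subseteq> padic_ints p" using assms(2) openin_mtopology by blast
  have "\<B> \<subseteq> (\<lambda>(c, n). {y\<in>padic_ints p. y n = c}) ` UNIV"
  proof
    fix A assume "A \<in> \<B>"
    then obtain x n where "x \<in> U" "A = padic_ball p x n" by (auto simp: \<B>_def)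
    hence "A = (\<lambda>(c, n). {y\<in>padic_ints p. y n = c}) (x n, n)" using U ball by auto
    thus "A \<in> (\<lambda>(c, n). {y\<in>padic_ints p. y n = c}) ` UNIV" by blast
  qed
  hence "countable \<B>" by (rule countable_subset) auto
  moreover have "\<B> \<subseteq> range (case_prod (padic_ball p))" by (auto simp: \<B>_def image_iff)
  moreover have "U = \<Union>\<B>"
  proof
    show "U \<subseteq> \<Union>\<B>"
    proof
      fix x assume x: "x \<in> U"
      then obtain r where r: "0 < r" "mcball x r \<subseteq> U"
        using assms(2) openin_mtopology_mcball by blast
      obtain n where n: "(1 / real p) ^ n < r" using real_arch_pow_inv[OF r(1), of "1 / real p"] p by auto
      hence "padic_ball p x n \<subseteq> U"
        using r(2) mcball_subset_concentric[of "1 / real p ^ n" r x]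
        unfolding padic_ball_def power_one_over by auto
      moreover have "x \<in> padic_ball p x n" using x U ball by auto
      ultimately show "x \<in> \<Union>\<B>" using x by (auto simp: \<B>_def)
    qed
  qed (auto simp: \<B>_def)
  ultimately show ?thesis by (rule that)
qed

text \<open>Closed sets, and more generally Borel sets, have the expected Hausdorff measure.\<close>

lemma space_hausdorff_measure: "space (hausdorff_measure p s) = padic_ints p"
  unfolding hausdorff_measure_def by (rule space_measure_of_conv)

lemma sets_hausdorff_measure:
  assumes "prime p"
  shows "sets (hausdorff_measure p s) = sigma_sets (padic_ints p) {U. openin (padic_topology p) U}"
  unfolding hausdorff_measure_def
  using openin_subset[of "padic_topology p"] Metric_space.topspace_mtopology[OF Metric_space_padic[OF assms]]
  by (intro sets_measure_of) auto

lemma emeasure_hausdorff_measure: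
  assumes "prime p" "A \<in> sets (hausdorff_measure p s)"
  shows "emeasure (hausdorff_measure p s) A = hausdorff_outer p s A"
proof -
  let ?L = "lambda_system (padic_ints p) (Pow (padic_ints p)) (hausdorff_outer p s)"
  let ?O = "{U. openin (padic_topology p) U}"
  interpret sigma_algebra "padic_ints p" "Pow (padic_ints p)" by (rule sigma_algebra_Pow)
  have L: "measure_space (padic_ints p) ?L (hausdorff_outer p s)"
    by (rule caratheodory_lemma[OF outer_measure_space_hausdorff])
  interpret L: sigma_algebra "padic_ints p" ?L using L by (simp add: measure_space_def)
  have O: "?O \<subseteq> Pow (padic_ints p)"
    using openin_subset[of "padic_topology p"]
      Metric_space.topspace_mtopology[OF Metric_space_padic[OF assms(1)]] by auto
  have "?O \<subseteq> ?L"
  proof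
    fix U assume "U \<in> ?O"
    then obtain \<B> where "countable \<B>" "\<B> \<subseteq> range (case_prod (padic_ball p))" "U = \<Union>\<B>"
      using openin_padic_countable_Union_balls[OF assms(1)] by blast
    moreover from this(2) have "\<B> \<subseteq> ?L" using padic_ball_in_lambda_system[OF assms(1)] by fastforce
    ultimately show "U \<in> ?L" using L.countable_Union by blast
  qed
  hence "sigma_sets (padic_ints p) ?O \<subseteq> ?L" by (rule L.sigma_sets_subset)
  hence "measure_space (padic_ints p) (sigma_sets (padic_ints p) ?O) (hausdorff_outer p s)"
    using measure_down[OF L] sigma_algebra_sigma_sets[OF O] by blast
  hence "positive (sets (hausdorff_measure p s)) (hausdorff_outer p s)"
        "countably_additive (sets (hausdorff_measure p s)) (hausdorff_outer p s)"
    by (simp_all add: sets_hausdorff_measure[OF assms(1)] measure_space_def)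
  thus ?thesis
    by (rule emeasure_measure_of[OF hausdorff_measure_def O _ _ assms(2)])
qed

end

theory Submission
  imports Defs
begin

text \<open>
  Only about \<open>|I| / p ^ n\<close> integers of an interval \<open>I\<close> lie in a ball \<open>B\<close> of radius \<open>r = p ^ - n\<close>, so
  a finite cover of \<open>F\<close> by such balls bounds the counting measure of \<open>F\<close> by the sum of
  \<open>\<eta> B * r ^ s\<close>, where \<open>\<eta> B\<close> is the relative density of \<open>F\<close> in \<open>B\<close>. As \<open>F\<close> is compact and balls are
  open, the same holds for countable covers. Let \<open>g N x\<close> be the supremum of the densities of the balls
  of radius at most \<open>p ^ - N\<close> around \<open>x\<close>. Cut \<open>F\<close> into thin level sets of \<open>g N\<close> and cover each of them
  almost optimally by small balls: every ball meeting a level set may be recentred in it, so its density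
  is at most the level. Hence the counting measure is at most the integral of \<open>g N\<close> over \<open>F\<close>, and
  letting \<open>N\<close> tend to infinity is justified because \<open>g N\<close> is bounded by \<open>C\<close> and \<open>F\<close> has finite
  measure.
\<close>

section \<open>Compactness of closed sets of p-adic integers\<close>

text \<open>Koenig's argument on the tree of residues: if \<open>F\<close> has no finite subcover,
  some branch of nested cylinders has none at any level. The branch is a p-adic integer, it lies in
  \<open>F\<close> by closedness, and the ball of the cover containing it swallows a whole cylinder,
  a contradiction.\<close>

lemma closedin_padic_finite_subcover:
  assumes "prime p" "closedin (padic_topology p) F"
    and cover: "F \<subseteq> (\<Union>i\<in>J. padic_ball p (a i) (k i))"
  obtains S where "finite S" "S \<subseteq> J" "F \<subseteq> (\<Union>i\<in>S. padic_ball p (a i) (k i))"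
proof (rule ccontr)
  assume "\<not> thesis"
  have p: "real p > 1" "int p > 0" using prime_gt_1_nat[OF assms(1)] by simp_all
  interpret Metric_space "padic_ints p" "padic_dist p" by (rule Metric_space_padic[OF assms(1)])
  note ball = in_padic_ball_iff[OF assms(1)]
  have F: "F \<subseteq> padic_ints p" using closedin_subset[OF assms(2)] by simp
  define small where "small A \<longleftrightarrow> (\<exists>S. finite S \<and> S \<subseteq> J \<and> A \<subseteq> (\<Union>i\<in>S. padic_ball p (a i) (k i)))" for A
  have small_UN: "small (\<Union>c\<in>D. A c)" if "finite D" "\<And>c. c \<in> D \<Longrightarrow> small (A c)" for D and A :: "int \<Rightarrow> padic set"
  proof -
    from that(2) obtain S where "\<And>c. c \<in> D \<Longrightarrow> finite (S c) \<and> S c \<subseteq> J \<and> A c \<subseteq> (\<Union>i\<in>S c. padic_ball p (a i) (k i))"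
      unfolding small_def by metis
    thus ?thesis unfolding small_def using that(1) by (intro exI[of _ "\<Union>c\<in>D. S c"]) blast
  qed
  have notF: "\<not> small F" using \<open>\<not> thesis\<close> that unfolding small_def by blast
  define cyl where "cyl n c = {x\<in>F. x n = c}" for n and c :: int
  \<comment> \<open>Only finitely many residues modulo \<open>p ^ Suc n\<close> reduce to
    \<open>c\<close>, and finite unions of \<open>small\<close> sets are \<open>small\<close>, so a
    bad cylinder has a bad child.\<close>
  have step: "\<exists>c'. \<not> small (cyl (Suc n) c') \<and> c' \<in> {0..<int p ^ Suc n} \<and> c' mod int p ^ n = c"
    if "\<not> small (cyl n c)" for n c
  proof (rule ccontr)
    assume *: "\<not> ?thesis"
    let ?D = "{c' \<in> {0..<int p ^ Suc n}. c' mod int p ^ n = c}"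
    have "x (Suc n) \<in> {0..<int p ^ Suc n} \<and> x (Suc n) mod int p ^ n = x n" if "x \<in> F" for x
      using F that unfolding padic_ints_def by blast
    hence "cyl n c \<subseteq> (\<Union>c'\<in>?D. cyl (Suc n) c')" unfolding cyl_def by blast
    moreover have "small (\<Union>c'\<in>?D. cyl (Suc n) c')"
      proof (rule small_UN)
      show "finite ?D" by (rule finite_subset[of _ "{0..<int p ^ Suc n}"]) auto
    qed (use * in auto)
    ultimately show False using that unfolding small_def by (meson order_trans)
  qed
  \<comment> \<open>Modulo \<open>p ^ 0 = 1\<close> there is one residue, so the root of the tree is
    all of \<open>F\<close>.\<close>
  have "x 0 = 0" if "x \<in> F" for x
  proof -
    have "x 0 \<in> {0..<int p ^ 0}" using F that unfolding padic_ints_def by blast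
    thus ?thesis by simp
  qed
  hence "cyl 0 0 = F" by (auto simp: cyl_def)
  hence "\<not> small (cyl 0 0) \<and> (0::int) \<in> {0..<int p ^ 0}" using notF by simp
  hence "\<exists>x. \<forall>n. (\<not> small (cyl n (x n)) \<and> x n \<in> {0..<int p ^ n}) \<and> x (Suc n) mod int p ^ n = x n"
    by (intro dependent_nat_choice) (use step in blast)+
  then obtain x where x: "\<And>n. \<not> small (cyl n (x n))" and xZ: "x \<in> padic_ints p"
    by (auto simp: padic_ints_def)
  have "x \<in> F"
  proof (rule ccontr)
    \<comment> \<open>Otherwise a ball around \<open>x\<close> misses \<open>F\<close>, so a deep
      cylinder along the branch is empty; but the empty set is covered by no balls at all, hence
      \<open>small\<close>.\<close>
    assume "x \<notin> F"
    then obtain r where r: "0 < r" "disjnt F (mball x r)"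
      using assms(2) xZ unfolding closedin_metric by blast
    obtain n where n: "(1 / real p) ^ n < r" using real_arch_pow_inv[OF r(1), of "1 / real p"] p by auto
    have "padic_ball p x n \<subseteq> mball x r"
      using n mcball_subset_mball_concentric[of "1 / real p ^ n" r x]
      unfolding padic_ball_def power_one_over by auto
    moreover have "cyl n (x n) \<subseteq> padic_ball p x n" using F xZ ball by (auto simp: cyl_def)
    ultimately have "cyl n (x n) = {}" using r(2) by (auto simp: cyl_def disjnt_def)
    thus False using x[of n] by (auto simp: small_def)
  qed
  then obtain i where i: "i \<in> J" "x \<in> padic_ball p (a i) (k i)" using cover by blast
  hence "cyl (k i) (x (k i)) \<subseteq> padic_ball p (a i) (k i)"
    using F ball by (auto simp: cyl_def)
  hence "small (cyl (k i) (x (k i)))" unfolding small_def by (intro exI[of _ "{i}"]) (use i in auto)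
  thus False using x by blast
qed

section \<open>Counting integers in residue classes and balls\<close>

text \<open>Within one residue class an integer is determined by its quotient by \<open>q\<close>,
  so it suffices to count quotients. Of the constant 2, one unit comes from including both end
  quotients and one from rounding \<open>M / q\<close> down.\<close>

lemma card_congruent_le:
  fixes M N q c :: int
  assumes "q > 0" "M \<le> N"
  shows "real (card {z\<in>{M<..N}. z mod q = c}) \<le> real_of_int (N - M) / real_of_int q + 2"
proof -
  have "inj_on (\<lambda>z. z div q) {z\<in>{M<..N}. z mod q = c}"
    by (rule inj_onI) (metis (mono_tags, lifting) mem_Collect_eq mult_div_mod_eq)
  moreover have "(\<lambda>z. z div q) ` {z\<in>{M<..N}. z mod q = c} \<subseteq> {M div q..N div q}"
    using assms by (auto intro!: zdiv_mono1)
  ultimately have "card {z\<in>{M<..N}. z mod q = c} \<le> card {M div q..N div q}"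
    by (meson card_inj_on_le finite_atLeastAtMost_int)
  also have "real \<dots> = real_of_int (N div q) - real_of_int (M div q) + 1"
    using zdiv_mono1[OF assms(2,1)] by simp
  also have "\<dots> \<le> real_of_int (N - M) / real_of_int q + 2"
  proof -
    have "real_of_int (N div q) \<le> real_of_int N / real_of_int q"
      by (simp add: floor_divide_of_int_eq[symmetric, where ?'a=real])
    moreover have "real_of_int M / real_of_int q - 1 \<le> real_of_int (M div q)"
      unfolding floor_divide_of_int_eq[symmetric, where ?'a=real] by linarith
    ultimately show ?thesis by (simp add: diff_divide_distrib)
  qed
  finally show ?thesis by simp
qed

lemma eventually_interval_limsup_less:
  assumes "interval_limsup f < c"
  shows "eventually (\<lambda>(M, N). f {M<..N} < c) (filtercomap (\<lambda>(M, N). N - M) at_top)"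
  using Limsup_lessD[OF assms[unfolded interval_limsup_def]] by (rule eventually_mono) auto

lemma interval_limsup_le:
  assumes "eventually (\<lambda>(M, N). f {M<..N} \<le> c) (filtercomap (\<lambda>(M, N). N - M) at_top)"
  shows "interval_limsup f \<le> c"
  unfolding interval_limsup_def by (rule Limsup_bounded, rule eventually_mono[OF assms]) auto

text \<open>The integers of a ball form a residue class modulo \<open>p ^ n\<close>, so their share
  of an interval \<open>I\<close> is at most \<open>1 / p ^ n + 2 / |I|\<close>. The error tends to
  0 and raising to the power \<open>s\<close> is continuous.\<close>

lemma eventually_padic_ball_density_le:
  assumes "prime p" "x \<in> padic_ints p" "s > 0" "e > 0"
  shows "eventually (\<lambda>(M, N). (real (card (padic_of_int p -` padic_ball p x n \<inter> {M<..N})) /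
      real (card {M<..N})) powr s \<le> (1 / real p ^ n) powr s + e)
    (filtercomap (\<lambda>(M, N). N - M) at_top)"
proof -
  have p: "real p > 0" "int p > 0" using prime_gt_0_nat[OF assms(1)] by simp_all
  have "((\<lambda>t. (1 / real p ^ n + 2 / t) powr s) \<longlongrightarrow> (1 / real p ^ n + 0) powr s) at_top"
    using p by (intro tendsto_intros tendsto_divide_0[OF tendsto_const] filterlim_at_top_imp_at_infinity filterlim_ident) auto
  hence "eventually (\<lambda>t. (1 / real p ^ n + 2 / t) powr s < (1 / real p ^ n) powr s + e) at_top"
    by (rule order_tendstoD) (use assms in simp)
  then obtain T where T: "\<And>t. t \<ge> T \<Longrightarrow> (1 / real p ^ n + 2 / t) powr s < (1 / real p ^ n) powr s + e"
    by (auto simp: eventually_at_top_linorder)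
  show ?thesis
    unfolding eventually_filtercomap_at_top_linorder
  \<comment> \<open>The 1 keeps the interval nonempty, so dividing by its length is
    legitimate.\<close>
  proof (intro exI[of _ "max 1 \<lceil>T\<rceil>"] allI impI, clarify)
    fix M N :: int assume MN: "max 1 \<lceil>T\<rceil> \<le> N - M"
    let ?A = "padic_of_int p -` padic_ball p x n \<inter> {M<..N}"
    have "?A \<subseteq> {z\<in>{M<..N}. z mod int p ^ n = x n}"
      by (auto simp: in_padic_ball_iff[OF assms(1)] padic_of_int_def)
    hence "card ?A \<le> card {z\<in>{M<..N}. z mod int p ^ n = x n}"
      by (intro card_mono finite_subset[of "{z\<in>{M<..N}. z mod int p ^ n = x n}" "{M<..N}"]) auto
    also have "real \<dots> \<le> real_of_int (N - M) / real_of_int (int p ^ n) + 2"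
      by (rule card_congruent_le) (use p MN in auto)
    finally have "real (card ?A) / real (card {M<..N}) \<le> (real_of_int (N - M) / real p ^ n + 2) / real_of_int (N - M)"
      using MN by (simp add: divide_right_mono)
    also have "\<dots> = 1 / real p ^ n + 2 / real_of_int (N - M)"
      using MN by (simp add: add_divide_distrib)
    finally have "(real (card ?A) / real (card {M<..N})) powr s \<le> (1 / real p ^ n + 2 / real_of_int (N - M)) powr s"
      using assms by (intro powr_mono2) auto
    also have "\<dots> < (1 / real p ^ n) powr s + e" by (rule T) (use MN in linarith)
    finally show "(real (card ?A) / real (card {M<..N})) powr s \<le> (1 / real p ^ n) powr s + e" by simp
  qed
qed

section \<open>Bounding the counting measure by covers\<close>

text \<open>Each term \<open>|F Int B Int I| / |I| powr s\<close> factors into the ratio defining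
  \<open>rel_density\<close> times the share of \<open>I\<close> in \<open>B\<close>, to the power
  \<open>s\<close>. Finiteness of the cover lets the bounds on both factors hold for all balls at
  once when \<open>I\<close> is long.\<close>

lemma counting_measure_le_sum_cover:
  assumes "prime p" "s > 0" "finite S"
    and cover: "F \<subseteq> (\<Union>i\<in>S. padic_ball p (a i) (k i))"
    and a: "\<And>i. i \<in> S \<Longrightarrow> a i \<in> padic_ints p"
    and fin: "\<And>i. i \<in> S \<Longrightarrow> rel_density p s F (padic_ball p (a i) (k i)) < \<infinity>"
  shows "counting_measure s (padic_of_int p -` F)
    \<le> (\<Sum>i\<in>S. rel_density p s F (padic_ball p (a i) (k i)) * ennreal ((1 / real p ^ k i) powr s))"
proof -
  define B where "B i = padic_ball p (a i) (k i)" for i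
  define D where "D i = enn2real (rel_density p s F (B i))" for i
  define r where "r i = (1 / real p ^ k i) powr s" for i
  let ?P = "padic_of_int p"
  let ?G = "filtercomap (\<lambda>(M, N). N - M) at_top :: (int \<times> int) filter"
  have D: "rel_density p s F (B i) = ennreal (D i)" "D i \<ge> 0" if "i \<in> S" for i
    using fin[OF that] by (simp_all add: D_def B_def)
  have r: "r i \<ge> 0" for i by (simp add: r_def)
  \<comment> \<open>Both factors get a slack \<open>e\<close>, removed at the end by letting
    \<open>e\<close> tend to 0.\<close>
  have bound: "counting_measure s (?P -` F) \<le> ennreal (\<Sum>i\<in>S. (D i + e) * (r i + e))" if e: "e > 0" for e :: real
  proof -
    have "eventually (\<lambda>(M, N). ennreal (real (card (?P -` (F \<inter> B i) \<inter> {M<..N})) /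
        real (card (?P -` B i \<inter> {M<..N})) powr s) < ennreal (D i + e)) ?G" if "i \<in> S" for i
      by (rule eventually_interval_limsup_less)
         (use D[OF that] e in \<open>simp add: rel_density_def ennreal_lessI\<close>)
    hence "eventually (\<lambda>x. \<forall>i\<in>S. case x of (M, N) \<Rightarrow> ennreal (real (card (?P -` (F \<inter> B i) \<inter> {M<..N})) /
        real (card (?P -` B i \<inter> {M<..N})) powr s) < ennreal (D i + e)) ?G"
      using assms(3) by (intro eventually_ball_finite) auto
    moreover have "eventually (\<lambda>x. \<forall>i\<in>S. case x of (M, N) \<Rightarrow> (real (card (?P -` B i \<inter> {M<..N})) /
        real (card {M<..N})) powr s \<le> r i + e) ?G"
      using assms(3) eventually_padic_ball_density_le[OF assms(1) a assms(2) e]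
      by (intro eventually_ball_finite) (auto simp: B_def r_def)
    ultimately have "eventually (\<lambda>(M, N). ennreal (real (card (?P -` F \<inter> {M<..N})) / real (card {M<..N}) powr s)
        \<le> ennreal (\<Sum>i\<in>S. (D i + e) * (r i + e))) ?G"
    proof eventually_elim
      case (elim x)
      obtain M N where x: "x = (M, N)" by (cases x)
      define I where "I = {M<..N}"
      have fI: "finite I" by (simp add: I_def)
      define u where "u i = real (card (?P -` (F \<inter> B i) \<inter> I)) / real (card (?P -` B i \<inter> I)) powr s" for i
      define v where "v i = (real (card (?P -` B i \<inter> I)) / real (card I)) powr s" for i
      have u: "u i \<le> D i + e" if "i \<in> S" for i
        using elim(1) that D(2)[OF that] e unfolding x by (fastforce simp: u_def I_def ennreal_less_iff)
      have v: "v i \<le> r i + e" if "i \<in> S" for i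
        using elim(2) that unfolding x by (auto simp: v_def I_def)
      have uv: "real (card (?P -` (F \<inter> B i) \<inter> I)) / real (card I) powr s = u i * v i" for i
      \<comment> \<open>If the ball has no integer in \<open>I\<close>, the left side and
        \<open>u i\<close> have numerator 0. Otherwise the power of its count cancels in the
        product.\<close>
      proof (cases "card (?P -` B i \<inter> I) = 0")
        case True
        hence "?P -` B i \<inter> I = {}" using fI by simp
        hence "?P -` (F \<inter> B i) \<inter> I = {}" by auto
        thus ?thesis by (simp add: u_def)
      next
        case False
        thus ?thesis by (simp add: u_def v_def powr_divide)
      qed
      have "?P -` F \<inter> I \<subseteq> (\<Union>i\<in>S. ?P -` (F \<inter> B i) \<inter> I)" using cover unfolding B_def by blast
      hence "card (?P -` F \<inter> I) \<le> card (\<Union>i\<in>S. ?P -` (F \<inter> B i) \<inter> I)"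
        using fI assms(3) by (intro card_mono) auto
      also have "\<dots> \<le> (\<Sum>i\<in>S. card (?P -` (F \<inter> B i) \<inter> I))"
        by (rule card_UN_le[OF assms(3)])
      finally have "real (card (?P -` F \<inter> I)) \<le> (\<Sum>i\<in>S. real (card (?P -` (F \<inter> B i) \<inter> I)))"
        by (simp flip: of_nat_sum)
      hence "real (card (?P -` F \<inter> I)) / real (card I) powr s
          \<le> (\<Sum>i\<in>S. real (card (?P -` (F \<inter> B i) \<inter> I))) / real (card I) powr s"
        by (intro divide_right_mono) auto
      also have "\<dots> = (\<Sum>i\<in>S. u i * v i)" by (simp only: sum_divide_distrib uv)
      also have "\<dots> \<le> (\<Sum>i\<in>S. (D i + e) * (r i + e))"
        using u v D(2) e by (intro sum_mono mult_mono) (auto simp: v_def add_nonneg_nonneg)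
      finally show ?case by (simp add: x I_def ennreal_leI)
    qed
    thus ?thesis unfolding counting_measure_def by (rule interval_limsup_le)
  qed
  have "((\<lambda>e. ennreal (\<Sum>i\<in>S. (D i + e) * (r i + e))) \<longlongrightarrow> ennreal (\<Sum>i\<in>S. (D i + 0) * (r i + 0))) (at_right 0)"
    by (intro tendsto_intros)
  hence "counting_measure s (?P -` F) \<le> ennreal (\<Sum>i\<in>S. (D i + 0) * (r i + 0))"
    by (rule tendsto_lowerbound) (auto intro: eventually_mono[OF eventually_at_right_less] bound)
  also have "\<dots> = (\<Sum>i\<in>S. ennreal (D i) * ennreal (r i))"
    using D(2) r by (subst sum_ennreal[symmetric]) (auto simp: ennreal_mult)
  finally show ?thesis using D(1) by (simp add: B_def r_def)
qed

text \<open>Near-optimal covers of the pieces by balls of radius below \<open>p ^ - N\<close>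
  together cover \<open>F\<close>, and compactness leaves finitely many balls. The total radius sum
  of those assigned to a piece approximates its Hausdorff measure, while \<open>c j\<close> bounds
  their densities.\<close>

lemma counting_measure_le_sum_pieces:
  assumes "prime p" "s > 0" "closedin (padic_topology p) F" "finite T"
    and F: "F \<subseteq> (\<Union>j\<in>T. E j)"
    and c: "\<And>j. j \<in> T \<Longrightarrow> c j < \<infinity>"
    and H: "\<And>j. j \<in> T \<Longrightarrow> hausdorff_outer p s (E j) < \<infinity>"
    and dens: "\<And>j x n. j \<in> T \<Longrightarrow> x \<in> E j \<Longrightarrow> n \<ge> N \<Longrightarrow> rel_density p s F (padic_ball p x n) \<le> c j"
  shows "counting_measure s (padic_of_int p -` F) \<le> (\<Sum>j\<in>T. c j * hausdorff_outer p s (E j))"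
proof -
  have p: "real p > 1" using prime_gt_1_nat[OF assms(1)] by simp
  define w where "w k = ennreal ((1 / real p ^ k) powr s)" for k :: nat
  have bound: "counting_measure s (padic_of_int p -` F) \<le> (\<Sum>j\<in>T. c j * (hausdorff_outer p s (E j) + ennreal e))"
    if e: "e > 0" for e
  proof -
    define good where "good j = (\<lambda>(a, k, J). (\<forall>i\<in>J. a i \<in> padic_ints p \<and> N \<le> k i) \<and>
        E j \<subseteq> (\<Union>i\<in>J. padic_ball p (a i) (k i)) \<and>
        (\<Sum>i. if i \<in> J then w (k i) else 0) \<le> hausdorff_outer p s (E j) + ennreal e)" for j
    have "\<exists>t. good j t" if j: "j \<in> T" for j
    proof -
      have "hausdorff_pre p s (1 / real p ^ N) (E j) \<le> hausdorff_outer p s (E j)"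
        unfolding hausdorff_outer_def using p by (intro SUP_upper) auto
      also have "\<dots> < hausdorff_outer p s (E j) + ennreal e" using H[OF j] e by (auto simp: less_top)
      finally obtain a k J where 1: "\<And>i. i \<in> J \<Longrightarrow> a i \<in> padic_ints p \<and> 1 / real p ^ k i < 1 / real p ^ N"
        and 2: "E j \<subseteq> (\<Union>i\<in>J. padic_ball p (a i) (k i))"
        and 3: "(\<Sum>i. if i \<in> J then ennreal ((1 / real p ^ k i) powr s) else 0) < hausdorff_outer p s (E j) + ennreal e"
        by (rule hausdorff_pre_close) (rule that)
      have "a i \<in> padic_ints p \<and> N \<le> k i" if "i \<in> J" for i
        using 1[OF that] p by (simp add: field_simps)
      hence "good j (a, k, J)"
        unfolding good_def w_def prod.case using 2 less_imp_le[OF 3] by (intro conjI ballI) auto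
      thus ?thesis by blast
    qed
    hence "\<exists>t. \<forall>j\<in>T. good j (t j)" by (intro bchoice) blast
    then obtain t where t: "\<And>j. j \<in> T \<Longrightarrow> good j (t j)" by blast
    define a k J where "a j = fst (t j)" and "k j = fst (snd (t j))" and "J j = snd (snd (t j))" for j
    have akJ: "good j (a j, k j, J j)" if "j \<in> T" for j
      using t[OF that] by (simp add: a_def k_def J_def)
    have 1: "a j i \<in> padic_ints p \<and> N \<le> k j i" if "j \<in> T" "i \<in> J j" for j i
      using akJ[OF that(1)] that(2) unfolding good_def by blast
    have 2: "E j \<subseteq> (\<Union>i\<in>J j. padic_ball p (a j i) (k j i))" if "j \<in> T" for j
      using akJ[OF that] unfolding good_def by blast
    have 3: "(\<Sum>i. if i \<in> J j then w (k j i) else 0) \<le> hausdorff_outer p s (E j) + ennreal e" if "j \<in> T" for j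
      using akJ[OF that] unfolding good_def by blast
    define B where "B = (\<lambda>(j, i). padic_ball p (a j i) (k j i))"
    \<comment> \<open>Balls that miss their own piece are dropped: \<open>dens\<close> controls only
      balls centred in the piece.\<close>
    define K where "K = {(j, i). j \<in> T \<and> i \<in> J j \<and> E j \<inter> B (j, i) \<noteq> {}}"
    have "F \<subseteq> (\<Union>z\<in>K. B z)"
    proof
      fix x assume "x \<in> F"
      then obtain j where j: "j \<in> T" "x \<in> E j" using F by blast
      then obtain i where "i \<in> J j" "x \<in> B (j, i)" using 2 unfolding B_def by fast
      thus "x \<in> (\<Union>z\<in>K. B z)" using j unfolding K_def by blast
    qed
    hence "F \<subseteq> (\<Union>z\<in>K. padic_ball p (a (fst z) (snd z)) (k (fst z) (snd z)))"
      by (simp add: B_def case_prod_beta)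
    then obtain S where S: "finite S" "S \<subseteq> K"
      and cov: "F \<subseteq> (\<Union>z\<in>S. padic_ball p (a (fst z) (snd z)) (k (fst z) (snd z)))"
      by (rule closedin_padic_finite_subcover[OF assms(1,3)])
    have le: "rel_density p s F (padic_ball p (a (fst z) (snd z)) (k (fst z) (snd z))) \<le> c (fst z)"
      if zS: "z \<in> S" for z
    proof -
      obtain j i where z: "z = (j, i)" by (cases z)
      then obtain x where x: "j \<in> T" "i \<in> J j" "x \<in> E j" "x \<in> padic_ball p (a j i) (k j i)"
        using subsetD[OF S(2) zS] by (auto simp: K_def B_def)
      \<comment> \<open>Ultrametric recentring: every point of a ball is a centre of it.\<close>
      hence "padic_ball p (a j i) (k j i) = padic_ball p x (k j i)"
        by (auto simp: in_padic_ball_iff[OF assms(1)])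
      thus ?thesis using dens[of j x "k j i"] 1 x z by simp
    qed
    define S' where "S' j = {i. (j, i) \<in> S}" for j
    have fS': "finite (S' j)" for j
      unfolding S'_def by (rule finite_subset[OF _ finite_imageI[OF S(1), of snd]]) force
    have S_eq: "S = Sigma T S'" using S(2) by (auto simp: S'_def K_def)
    have "counting_measure s (padic_of_int p -` F)
        \<le> (\<Sum>z\<in>S. rel_density p s F (padic_ball p (a (fst z) (snd z)) (k (fst z) (snd z))) * w (k (fst z) (snd z)))"
      unfolding w_def
    proof (rule counting_measure_le_sum_cover[OF assms(1,2) S(1) cov])
      fix z assume z: "z \<in> S"
      show "a (fst z) (snd z) \<in> padic_ints p" using 1 z S(2) by (auto simp: K_def)
      show "rel_density p s F (padic_ball p (a (fst z) (snd z)) (k (fst z) (snd z))) < \<infinity>"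
        using le[OF z] c[of "fst z"] z S(2) by (auto simp: K_def intro: le_less_trans)
    qed
    also have "\<dots> \<le> (\<Sum>z\<in>S. c (fst z) * w (k (fst z) (snd z)))"
      by (intro sum_mono mult_right_mono le) auto
    also have "\<dots> = (\<Sum>j\<in>T. \<Sum>i\<in>S' j. c j * w (k j i))"
      unfolding S_eq by (subst sum.Sigma) (use assms(4) fS' in \<open>auto simp: case_prod_beta\<close>)
    also have "\<dots> = (\<Sum>j\<in>T. c j * (\<Sum>i\<in>S' j. w (k j i)))" by (simp add: sum_distrib_left)
    also have "\<dots> \<le> (\<Sum>j\<in>T. c j * (hausdorff_outer p s (E j) + ennreal e))"
    proof (intro sum_mono mult_left_mono)
      fix j assume j: "j \<in> T"
      have "(\<Sum>i\<in>S' j. w (k j i)) = (\<Sum>i\<in>S' j. if i \<in> J j then w (k j i) else 0)"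
        using S(2) by (intro sum.cong) (auto simp: S'_def K_def)
      also have "\<dots> \<le> (\<Sum>i. if i \<in> J j then w (k j i) else 0)"
        by (rule sum_le_suminf) (use fS' in auto)
      also note 3[OF j]
      finally show "(\<Sum>i\<in>S' j. w (k j i)) \<le> hausdorff_outer p s (E j) + ennreal e" .
    qed auto
    finally show ?thesis .
  qed
  \<comment> \<open>Finiteness of each \<open>c j\<close> makes multiplication by it continuous on
    the extended half-line.\<close>
  have "((\<lambda>e. \<Sum>j\<in>T. c j * (hausdorff_outer p s (E j) + ennreal e)) \<longlongrightarrow>
      (\<Sum>j\<in>T. c j * (hausdorff_outer p s (E j) + ennreal 0))) (at_right 0)"
    by (intro tendsto_sum ennreal_tendsto_cmult tendsto_add tendsto_const tendsto_ennrealI tendsto_ident_at)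
       (use c in auto)
  hence "counting_measure s (padic_of_int p -` F) \<le> (\<Sum>j\<in>T. c j * (hausdorff_outer p s (E j) + ennreal 0))"
    by (rule tendsto_lowerbound) (auto intro: eventually_mono[OF eventually_at_right_less] bound)
  thus ?thesis by simp
qed

section \<open>Measurability\<close>

text \<open>The integers are countable, so fibres suffice; each is empty or a ball, and balls are
  closed.\<close>

lemma measurable_padic_coordinate:
  assumes "prime p"
  shows "(\<lambda>x. x n) \<in> measurable (hausdorff_measure p s) (count_space UNIV)"
  unfolding measurable_count_space_eq2_countable
proof (intro conjI ballI)
  fix c :: int
  show "(\<lambda>x. x n) -` {c} \<inter> space (hausdorff_measure p s) \<in> sets (hausdorff_measure p s)"
  proof (cases "\<exists>x\<in>padic_ints p. x n = c")
    case True
    then obtain x where "x \<in> padic_ints p" "x n = c" by blast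
    hence eq: "(\<lambda>x. x n) -` {c} \<inter> space (hausdorff_measure p s) = padic_ball p x n"
      by (auto simp: space_hausdorff_measure in_padic_ball_iff[OF assms])
    interpret Metric_space "padic_ints p" "padic_dist p" by (rule Metric_space_padic[OF assms])
    have "openin mtopology (padic_ints p - padic_ball p x n)"
      unfolding padic_ball_def using openin_diff[OF openin_topspace closedin_mcball, of x "1 / real p ^ n"] by simp
    hence "padic_ints p - (padic_ints p - padic_ball p x n) \<in> sets (hausdorff_measure p s)"
      unfolding sets_hausdorff_measure[OF assms] by (intro sigma_sets.Compl sigma_sets.Basic) auto
    moreover have "padic_ints p - (padic_ints p - padic_ball p x n) = padic_ball p x n"
      by (auto simp: in_padic_ball_iff[OF assms])
    ultimately show ?thesis using eq by simp
  next
    case False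
    hence "(\<lambda>x. x n) -` {c} \<inter> space (hausdorff_measure p s) = {}"
      by (auto simp: space_hausdorff_measure)
    thus ?thesis by simp
  qed
qed simp

lemma closedin_padic_in_sets:
  assumes "prime p" "closedin (padic_topology p) F"
  shows "F \<in> sets (hausdorff_measure p s)"
proof -
  interpret Metric_space "padic_ints p" "padic_dist p" by (rule Metric_space_padic[OF assms(1)])
  have "openin mtopology (padic_ints p - F)" and F: "F \<subseteq> padic_ints p"
    using assms(2) by (simp_all add: closedin_def)
  hence "padic_ints p - (padic_ints p - F) \<in> sets (hausdorff_measure p s)"
    unfolding sets_hausdorff_measure[OF assms(1)] by (intro sigma_sets.Compl sigma_sets.Basic) auto
  thus ?thesis using F by (simp add: double_diff)
qed

text \<open>On p-adic integers the ball of exponent \<open>n\<close> around \<open>x\<close> depends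
  only on the residue \<open>x n\<close>. Hence any function of it factors through a discrete space,
  on which every map is measurable.\<close>

lemma measurable_ball_function:
  assumes "prime p"
  shows "(\<lambda>x. f (padic_ball p x n)) \<in> borel_measurable (hausdorff_measure p s)"
proof -
  have "(\<lambda>x. (\<lambda>c. f {y\<in>padic_ints p. y n = c}) (x n)) \<in> borel_measurable (hausdorff_measure p s)"
    by (rule measurable_compose[OF measurable_padic_coordinate[OF assms]]) simp
  moreover have "padic_ball p x n = {y\<in>padic_ints p. y n = x n}" if "x \<in> padic_ints p" for x
    using that by (auto simp: in_padic_ball_iff[OF assms])
  ultimately show ?thesis
    by (subst measurable_cong[where g = "\<lambda>x. f {y\<in>padic_ints p. y n = x n}"])
       (auto simp: space_hausdorff_measure)
qed

section \<open>From level sets to the integral\<close>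

text \<open>Slicing the range of the supremum into steps of height \<open>e\<close> costs at most
  \<open>e\<close> times the measure of \<open>F\<close>, which vanishes with \<open>e\<close>
  because that measure is finite.\<close>

lemma counting_measure_le_nn_integral_SUP:
  assumes "prime p" "s > 0" "closedin (padic_topology p) F" "hausdorff_outer p s F < \<infinity>"
    and C: "C > 0" "\<And>x n. x \<in> padic_ints p \<Longrightarrow> rel_density p s F (padic_ball p x n) \<le> ennreal C"
  shows "counting_measure s (padic_of_int p -` F)
    \<le> (\<integral>\<^sup>+x\<in>F. (SUP n\<in>{N..}. rel_density p s F (padic_ball p x n)) \<partial>hausdorff_measure p s)"
proof -
  let ?M = "hausdorff_measure p s"
  define g where "g x = (SUP n\<in>{N..}. rel_density p s F (padic_ball p x n))" for x
  have [measurable]: "g \<in> borel_measurable ?M"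
    unfolding g_def by (intro borel_measurable_SUP measurable_ball_function assms) auto
  have FM [measurable]: "F \<in> sets ?M" by (rule closedin_padic_in_sets[OF assms(1,3)])
  have FZ: "F \<subseteq> padic_ints p" using sets.sets_into_space[OF FM] by (simp add: space_hausdorff_measure)
  have gC: "g x \<le> ennreal C" if "x \<in> F" for x
    unfolding g_def by (rule SUP_least) (use C(2) FZ that in auto)
  have g: "g x = ennreal (enn2real (g x))" "enn2real (g x) \<le> C" if "x \<in> F" for x
  proof -
    have "g x < top" using gC[OF that] ennreal_less_top by (rule le_less_trans)
    thus "g x = ennreal (enn2real (g x))" by simp
    show "enn2real (g x) \<le> C" using gC[OF that] C(1) by (intro enn2real_leI) auto
  qed
  have bound: "counting_measure s (padic_of_int p -` F) \<le> (\<integral>\<^sup>+x\<in>F. g x \<partial>?M) + hausdorff_outer p s F * ennreal e"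
    if e: "e > 0" for e
  proof -
    \<comment> \<open>\<open>l x\<close> indexes the step containing \<open>g x\<close>, and
      \<open>c j\<close> is the upper end of step \<open>j\<close>, so \<open>c (l x)\<close>
      exceeds \<open>g x\<close> by at most \<open>e\<close>. The bound \<open>C\<close> on
      \<open>g\<close> over \<open>F\<close> makes \<open>T\<close> finite and the passage to reals
      faithful there.\<close>
    define l where "l x = \<lfloor>enn2real (g x) / e\<rfloor>" for x
    define E where "E j = {x\<in>space ?M. x \<in> F \<and> l x = j}" for j
    define c where "c j = ennreal ((of_int j + 1) * e)" for j :: int
    define T where "T = {0..\<lfloor>C / e\<rfloor>}"
    have EM [measurable]: "E j \<in> sets ?M" for j unfolding E_def l_def by measurable
    have l: "l x \<in> T" if "x \<in> F" for x
      using g(2)[OF that] e by (auto simp: T_def l_def intro!: floor_mono divide_right_mono)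
    have gc: "g x \<le> c (l x)" and cg: "c (l x) \<le> g x + ennreal e" if "x \<in> F" for x
    proof -
      have fl: "of_int (l x) \<le> enn2real (g x) / e" "enn2real (g x) / e \<le> of_int (l x) + 1"
        unfolding l_def by linarith+
      have "enn2real (g x) \<le> (of_int (l x) + 1) * e" using fl(2) e by (simp add: field_simps)
      thus "g x \<le> c (l x)" unfolding c_def by (subst g(1)[OF that]) (rule ennreal_leI)
      have "(of_int (l x) + 1) * e \<le> enn2real (g x) + e" using fl(1) e by (simp add: field_simps)
      hence "c (l x) \<le> ennreal (enn2real (g x) + e)" unfolding c_def by (rule ennreal_leI)
      also have "\<dots> = g x + ennreal e" using e g(1)[OF that] by simp
      finally show "c (l x) \<le> g x + ennreal e" .
    qed
    have H: "emeasure ?M A = hausdorff_outer p s A" if "A \<in> sets ?M" for A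
      by (rule emeasure_hausdorff_measure[OF assms(1) that])
    have "counting_measure s (padic_of_int p -` F) \<le> (\<Sum>j\<in>T. c j * hausdorff_outer p s (E j))"
    proof (rule counting_measure_le_sum_pieces[OF assms(1-3)])
      show "finite T" by (simp add: T_def)
      show "F \<subseteq> (\<Union>j\<in>T. E j)" using l FZ by (auto simp: E_def space_hausdorff_measure)
      show "c j < \<infinity>" for j by (simp add: c_def)
      show "hausdorff_outer p s (E j) < \<infinity>" for j
      proof -
        have "emeasure ?M (E j) \<le> emeasure ?M F" by (rule emeasure_mono) (auto simp: E_def FM)
        thus ?thesis using assms(4) by (simp add: H EM FM)
      qed
      show "rel_density p s F (padic_ball p x n) \<le> c j" if "x \<in> E j" "n \<ge> N" for j x n
      proof -
        have "rel_density p s F (padic_ball p x n) \<le> g x"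
          unfolding g_def using that(2) by (intro SUP_upper) auto
        also have "\<dots> \<le> c j" using gc[of x] that(1) by (auto simp: E_def)
        finally show ?thesis .
      qed
    qed
    also have "\<dots> = (\<Sum>j\<in>T. \<integral>\<^sup>+x. c j * indicator (E j) x \<partial>?M)"
      by (simp add: nn_integral_cmult_indicator H EM)
    also have "\<dots> = (\<integral>\<^sup>+x. (\<Sum>j\<in>T. c j * indicator (E j) x) \<partial>?M)"
      by (rule nn_integral_sum[symmetric]) measurable
    also have "\<dots> \<le> (\<integral>\<^sup>+x. g x * indicator F x + ennreal e * indicator F x \<partial>?M)"
    proof (rule nn_integral_mono)
      fix x assume "x \<in> space ?M"
      show "(\<Sum>j\<in>T. c j * indicator (E j) x) \<le> g x * indicator F x + ennreal e * indicator F x"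
      proof (cases "x \<in> F")
        case True
        \<comment> \<open>The sets \<open>E j\<close> partition \<open>F\<close>, so only the term
          \<open>j = l x\<close> survives.\<close>
        have "(\<Sum>j\<in>T. c j * indicator (E j) x) = (\<Sum>j\<in>T. if j = l x then c j else 0)"
          using True \<open>x \<in> space ?M\<close> by (intro sum.cong) (auto simp: E_def)
        also have "\<dots> = c (l x)" using l[OF True] by (simp add: T_def)
        finally show ?thesis using cg[OF True] True by simp
      qed (simp add: E_def)
    qed
    also have "\<dots> = (\<integral>\<^sup>+x\<in>F. g x \<partial>?M) + hausdorff_outer p s F * ennreal e"
      by (subst nn_integral_add) (auto simp: nn_integral_cmult_indicator H FM mult.commute)
    finally show ?thesis .
  qed
  have "((\<lambda>e. (\<integral>\<^sup>+x\<in>F. g x \<partial>?M) + hausdorff_outer p s F * ennreal e) \<longlongrightarrow>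
      (\<integral>\<^sup>+x\<in>F. g x \<partial>?M) + hausdorff_outer p s F * ennreal 0) (at_right 0)"
    by (intro tendsto_add tendsto_const ennreal_tendsto_cmult tendsto_ennrealI tendsto_ident_at)
       (use assms(4) in auto)
  hence "counting_measure s (padic_of_int p -` F) \<le> (\<integral>\<^sup>+x\<in>F. g x \<partial>?M) + hausdorff_outer p s F * ennreal 0"
    by (rule tendsto_lowerbound) (auto intro: eventually_mono[OF eventually_at_right_less] bound)
  thus ?thesis by (simp add: g_def)
qed

theorem theoremB:
  fixes p :: nat and s C :: real and F :: "padic set"
  assumes "prime p"
    and "s > 0"
    and "closedin (padic_topology p) F"
    and "hausdorff_outer p s F < \<infinity>"
    and "C > 0"
    and "\<And>x n. x \<in> padic_ints p \<Longrightarrow> rel_density p s F (padic_ball p x n) \<le> ennreal C"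
  shows "counting_measure s (padic_of_int p -` F)
           \<le> (\<integral>\<^sup>+ x\<in>F. local_density p s F x \<partial>hausdorff_measure p s)"
proof -
  let ?M = "hausdorff_measure p s"
  define g where "g N x = (SUP n\<in>{N..}. rel_density p s F (padic_ball p x n))" for N x
  have [measurable]: "g N \<in> borel_measurable ?M" for N
    unfolding g_def by (intro borel_measurable_SUP measurable_ball_function assms) auto
  have FM [measurable]: "F \<in> sets ?M" by (rule closedin_padic_in_sets[OF assms(1,3)])
  have FZ: "F \<subseteq> padic_ints p" using sets.sets_into_space[OF FM] by (simp add: space_hausdorff_measure)
  \<comment> \<open>A finite integral of the largest function \<open>g 0\<close> licenses monotone
    convergence for the decreasing sequence \<open>g N\<close>.\<close>
  have "(\<integral>\<^sup>+x\<in>F. g 0 x \<partial>?M) \<le> (\<integral>\<^sup>+x. ennreal C * indicator F x \<partial>?M)"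
    using assms(6) FZ by (intro nn_integral_mono) (auto simp: g_def indicator_def intro!: SUP_least)
  also have "\<dots> = ennreal C * hausdorff_outer p s F"
    by (simp add: nn_integral_cmult_indicator emeasure_hausdorff_measure[OF assms(1) FM] FM)
  also have "\<dots> < \<infinity>" using assms(4) by (simp add: ennreal_mult_less_top)
  finally have fin: "(\<integral>\<^sup>+x\<in>F. g 0 x \<partial>?M) < \<infinity>" .
  have "counting_measure s (padic_of_int p -` F) \<le> (INF N. \<integral>\<^sup>+x\<in>F. g N x \<partial>?M)"
    unfolding g_def by (rule INF_greatest) (rule counting_measure_le_nn_integral_SUP[OF assms])
  also have "\<dots> = (\<integral>\<^sup>+x. (INF N. g N x * indicator F x) \<partial>?M)"
  proof (rule nn_integral_monotone_convergence_INF_decseq[symmetric])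
    show "decseq (\<lambda>N x. g N x * indicator F x)"
      unfolding g_def by (intro decseq_SucI le_funI mult_right_mono SUP_subset_mono) auto
  qed (use fin in auto)
  \<comment> \<open>On \<open>F\<close> the infimum of the tail suprema is the upper limit defining
    \<open>local_density\<close>; off \<open>F\<close> both integrands are 0.\<close>
  also have "\<dots> = (\<integral>\<^sup>+x\<in>F. local_density p s F x \<partial>?M)"
    by (intro nn_integral_cong)
       (auto simp: indicator_def local_density_def g_def limsup_INF_SUP)
  finally show ?thesis .
qed

end
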